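(* Let $\nu$ be a Lévy measure on $\mathbb R^d$ with $\int_{\mathbb R^d}\|x\|^3\,\nu(dx)<\infty$, and for $\varepsilon>0$ let $\nu_\varepsilon$ be the measure of the 3-moment scheme (defined in the context). For every $\varepsilon>0$, $\nu_\varepsilon$ is a finite positive measure satisfying, for all $1\le i,j,k\le d$, $$\int_{\mathbb R^d}x_ix_j\,\nu(dx)=\int_{\mathbb R^d}x_ix_j\,\nu_\varepsilon(dx),\qquad \int_{\mathbb R^d}x_ix_jx_k\,\nu(dx)=\int_{\mathbb R^d}x_ix_jx_k\,\nu_\varepsilon(dx),$$ $$\lambda_\varepsilon:=\int_{\mathbb R^d}\nu_\varepsilon(dx)=\int_{\|x\|>\varepsilon}\nu(dx)+\varepsilon^{-2}\int_{\|x\|\le\varepsilon}\|x\|^2\,\nu(dx),$$ $$\int_{\mathbb R^d}\|x\|^4\,|d\nu-d\nu_\varepsilon|\le\int_{\|x\|\le\varepsilon}\|x\|^4\,\nu(dx)+\varepsilon^2\int_{\|x\|\le\varepsilon}\|x\|^2\,\nu(dx),$$ where the last inequality is an equality if $\nu(\{x:\|x\|=\varepsilon\})=0$.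
   Context: A Lévy measure is a measure $\nu$ on $\mathbb R^d$ with $\nu(\{0\})=0$ and $\int(1\wedge\|x\|^2)\nu(dx)<\infty$. Let $S^{d-1}$ be the unit sphere of $\mathbb R^d$; write $\nu(dr,d\theta)$ for $\nu$ in spherical coordinates $x=r\theta$, $r\in[0,\infty)$, $\theta\in S^{d-1}$. Let $\bar\nu(B)=\nu(\{x:-x\in B\})$ be the reflection of $\nu$. Define on $S^{d-1}$ the (signed, respectively positive) measures $$\bar\lambda(d\theta)=\tfrac12\int_{r\le\varepsilon}\frac{r^3}{\varepsilon^3}\bigl(\nu(dr,d\theta)-\bar\nu(dr,d\theta)\bigr),\qquad \lambda(d\theta)=\tfrac12\int_{r\le\varepsilon}\frac{r^2}{\varepsilon^2}\bigl(\nu(dr,d\theta)+\bar\nu(dr,d\theta)\bigr).$$ The 3-moment scheme measure is, in spherical coordinates, $$\nu_\varepsilon(dr,d\theta)=\nu(dr,d\theta)\,1_{r>\varepsilon}+\delta_\varepsilon(dr)\,\{\lambda(d\theta)+\bar\lambda(d\theta)\},$$ where $\delta_\varepsilon$ is the point mass at $\varepsilon$. $|d\nu-d\nu_\varepsilon|$ denotes integration against the total variation of $\nu-\nu_\varepsilon$, i.e. against $|p-p_\varepsilon|\,d\rho$ where $p,p_\varepsilon$ are the densities of $\nu,\nu_\varepsilon$ with respect to $\rho=\nu+\nu_\varepsilon$. *)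

theory Defs
  imports "HOL-Analysis.Analysis"
begin

definition levy_measure :: "(real ^ 'd) measure \<Rightarrow> bool" where
  "levy_measure \<nu> \<longleftrightarrow>
     sets \<nu> = sets borel \<and> emeasure \<nu> {0} = 0 \<and>
     (\<integral>\<^sup>+ x. ennreal (min 1 ((norm x)\<^sup>2)) \<partial>\<nu>) < \<infinity>"

definition reflection :: "(real ^ 'd) measure \<Rightarrow> (real ^ 'd) measure" where
  "reflection \<nu> = distr \<nu> borel uminus"

text \<open>
  The image of \<open>\<nu>\<close> under \<open>x \<mapsto> (r, \<theta>)\<close>, \<open>r = \<parallel>x\<parallel>\<close>, \<open>\<theta> = x / \<parallel>x\<parallel>\<close>. Note \<open>sgn 0 = 0\<close> is not on the
  sphere; this is harmless because a Levy measure does not charge the origin.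
\<close>

definition spherical :: "(real ^ 'd) measure \<Rightarrow> (real \<times> (real ^ 'd)) measure" where
  "spherical \<nu> = distr \<nu> (borel \<Otimes>\<^sub>M borel) (\<lambda>x. (norm x, sgn x))"

text \<open>
  The two angular measures, as real set functions on Borel subsets of the unit sphere. All the
  integrals are finite for a Levy measure; \<open>angular_odd\<close> is signed.
\<close>

definition angular_odd :: "(real ^ 'd) measure \<Rightarrow> real \<Rightarrow> (real ^ 'd) set \<Rightarrow> real" where
  "angular_odd \<nu> \<epsilon> A = 1/2 *
     ((LINT z:{0..\<epsilon>} \<times> A | spherical \<nu>. (fst z)^3 / \<epsilon>^3) -
      (LINT z:{0..\<epsilon>} \<times> A | spherical (reflection \<nu>). (fst z)^3 / \<epsilon>^3))"

definition angular_even :: "(real ^ 'd) measure \<Rightarrow> real \<Rightarrow> (real ^ 'd) set \<Rightarrow> real" where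
  "angular_even \<nu> \<epsilon> A = 1/2 *
     ((LINT z:{0..\<epsilon>} \<times> A | spherical \<nu>. (fst z)^2 / \<epsilon>^2) +
      (LINT z:{0..\<epsilon>} \<times> A | spherical (reflection \<nu>). (fst z)^2 / \<epsilon>^2))"

text \<open>
  The set function \<open>\<nu>(dr, d\<theta>) 1\<^bsub>r > \<epsilon>\<^esub> + \<delta>\<^sub>\<epsilon>(dr) {\<lambda>(d\<theta>) + \<lambda>'(d\<theta>)}\<close> in Cartesian coordinates, with
  \<open>\<lambda>\<close> and \<open>\<lambda>'\<close> the even and odd angular measures. It is extended-real valued, since its
  nonnegativity is not known beforehand.
\<close>

definition three_moment_charge :: "(real ^ 'd) measure \<Rightarrow> real \<Rightarrow> (real ^ 'd) set \<Rightarrow> ereal" where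
  "three_moment_charge \<nu> \<epsilon> B =
     enn2ereal (emeasure \<nu> {x \<in> B. norm x > \<epsilon>}) +
     ereal (angular_even \<nu> \<epsilon> {\<theta> \<in> sphere 0 1. \<epsilon> *\<^sub>R \<theta> \<in> B} +
            angular_odd \<nu> \<epsilon> {\<theta> \<in> sphere 0 1. \<epsilon> *\<^sub>R \<theta> \<in> B})"

text \<open>
  \<open>e2ennreal\<close> cuts off negative values, and \<open>measure_of\<close> yields the null measure when the set
  function is not countably additive. Hence the positivity of the scheme measure amounts to
  \<open>enn2ereal (emeasure (three_moment_measure \<nu> \<epsilon>) B) = three_moment_charge \<nu> \<epsilon> B\<close> for all Borel \<open>B\<close>.
\<close>

definition three_moment_measure :: "(real ^ 'd) measure \<Rightarrow> real \<Rightarrow> (real ^ 'd) measure" where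
  "three_moment_measure \<nu> \<epsilon> =
     measure_of UNIV (sets borel) (\<lambda>B. e2ennreal (three_moment_charge \<nu> \<epsilon> B))"

definition sum_measure :: "'a measure \<Rightarrow> 'a measure \<Rightarrow> 'a measure" where
  "sum_measure M N = measure_of (space M) (sets M) (\<lambda>A. emeasure M A + emeasure N A)"

lemma emeasure_sum_measure:
  assumes "sets N = sets M" "A \<in> sets M"
  shows "emeasure (sum_measure M N) A = emeasure M A + emeasure N A"
  unfolding sum_measure_def
proof (rule emeasure_measure_of_sigma)
  show "countably_additive (sets M) (\<lambda>A. emeasure M A + emeasure N A)"
  proof (rule countably_additiveI)
    fix F :: "nat \<Rightarrow> _"
    assume F: "range F \<subseteq> sets M" "disjoint_family F"
    have "(\<Sum>i. emeasure M (F i) + emeasure N (F i)) =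
        (\<Sum>i. emeasure M (F i)) + (\<Sum>i. emeasure N (F i))"
      by (rule suminf_add[symmetric]) auto
    with F show "(\<Sum>i. emeasure M (F i) + emeasure N (F i)) =
        emeasure M (\<Union>i. F i) + emeasure N (\<Union>i. F i)"
      by (simp add: suminf_emeasure assms(1))
  qed
qed (use assms in \<open>auto simp: positive_def sets.sigma_algebra_axioms\<close>)

text \<open>
  The integral of \<open>f\<close> against \<open>|dM - dN| = |p - q| d\<rho>\<close>, where \<open>p\<close> and \<open>q\<close> are the densities of
  \<open>M\<close> and \<open>N\<close> with respect to \<open>\<rho> = M + N\<close>. The densities exist for sigma-finite \<open>M\<close> and \<open>N\<close> and are
  almost everywhere at most \<open>1\<close>.
\<close>

definition nn_integral_abs_diff ::
    "'a measure \<Rightarrow> 'a measure \<Rightarrow> ('a \<Rightarrow> ennreal) \<Rightarrow> ennreal" where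
  "nn_integral_abs_diff M N f =
     (let \<rho> = sum_measure M N in
       \<integral>\<^sup>+ x. f x * ennreal \<bar>enn2real (RN_deriv \<rho> M x) - enn2real (RN_deriv \<rho> N x)\<bar> \<partial>\<rho>)"

end

theory Submission
  imports Defs
begin

text \<open>
  The scheme measure keeps the mass outside the ball of radius \<open>\<epsilon>\<close>. The remaining mass is moved
  along rays: a point \<open>x\<close> with \<open>r = \<parallel>x\<parallel>\<close> and \<open>0 < r \<le> \<epsilon>\<close>
  is replaced by the two points \<open>\<plusminus>\<epsilon> x / r\<close> of the sphere with weights
  \<open>(r\<^sup>2/\<epsilon>\<^sup>2 \<plusminus> r\<^sup>3/\<epsilon>\<^sup>3) / 2\<close>. The reflected terms of the angular measures are exactly the masses that
  arrive at the antipodal points. This description, \<open>scheme\<close>, is equal to the three-moment measure by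
  \<open>three_moment_measure_eq_scheme\<close>. It makes positivity evident, because both weights are nonnegative for
  \<open>r \<le> \<epsilon>\<close>.

  All moment identities hold already for a single point. The weights have sum \<open>r\<^sup>2/\<epsilon>\<^sup>2\<close> and difference
  \<open>r\<^sup>3/\<epsilon>\<^sup>3\<close>. The sum gives the total mass, and it preserves functions that are homogeneous of degree
  two, since these take the value \<open>\<epsilon>\<^sup>2/r\<^sup>2 f x\<close> at both new points. The difference preserves those of degree three,
  which take the values \<open>\<plusminus>\<epsilon>\<^sup>3/r\<^sup>3 f x\<close> (\<open>homogeneous_moment\<close>).

  For the fourth moment of the total variation, the space is divided into the outside of the ball, where the
  measures agree, the open ball, where only the original measure has mass, and the sphere, where the
  total variation is at most the sum of both measures. The projected mass on the sphere contributes
  \<open>\<epsilon>\<^sup>4 \<cdot> \<epsilon>\<^sup>-\<^sup>2 \<integral> r\<^sup>2\<close>. If the original measure does not charge the sphere, nothing cancels and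
  the bound is attained (\<open>abs_diff_scheme\<close>).
\<close>

section \<open>Integration against a sum of two measures\<close>

lemma space_sum_measure [simp]: "space (sum_measure M N) = space M"
  and sets_sum_measure [simp, measurable_cong]: "sets (sum_measure M N) = sets M"
  unfolding sum_measure_def by (simp_all add: sets.space_closed)

lemma nn_integral_sum_measure:
  assumes sets: "sets N = sets M" and f: "f \<in> borel_measurable M"
  shows "(\<integral>\<^sup>+ x. f x \<partial>sum_measure M N) = (\<integral>\<^sup>+ x. f x \<partial>M) + (\<integral>\<^sup>+ x. f x \<partial>N)"
proof -
  note meas_eq = measurable_cong_sets[OF sets refl] measurable_cong_sets[OF sets_sum_measure refl]
  show ?thesis
    using f
  proof (induction rule: borel_measurable_induct)
    case (cong f g)
    then have "(\<integral>\<^sup>+ x. f x \<partial>K) = (\<integral>\<^sup>+ x. g x \<partial>K)" if "space K = space M" for K :: "'a measure"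
      using that by (auto intro: nn_integral_cong)
    with cong show ?case
      using sets_eq_imp_space_eq[OF sets] by simp
  next
    case (set A)
    then show ?case
      using sets by (simp add: emeasure_sum_measure)
  next
    case (mult u c)
    moreover have "u \<in> borel_measurable N" "u \<in> borel_measurable (sum_measure M N)"
      using mult(2) by (simp_all add: meas_eq)
    ultimately show ?case
      by (simp add: nn_integral_cmult distrib_left)
  next
    case (add u v)
    moreover have "u \<in> borel_measurable N" "u \<in> borel_measurable (sum_measure M N)"
      "v \<in> borel_measurable N" "v \<in> borel_measurable (sum_measure M N)"
      using add by (simp_all add: meas_eq)
    ultimately show ?case
      by (simp add: nn_integral_add algebra_simps)
  next
    case (seq U)
    have meas: "U i \<in> borel_measurable N" "U i \<in> borel_measurable (sum_measure M N)" for i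
      using seq(1) by (simp_all add: meas_eq)
    have inc: "incseq (\<lambda>i. \<integral>\<^sup>+ x. U i x \<partial>K)" for K :: "'a measure"
      using seq(3) by (auto simp: incseq_def le_fun_def intro!: nn_integral_mono)
    show ?case
      unfolding SUP_apply
      by (simp add: nn_integral_monotone_convergence_SUP seq meas ennreal_SUP_add inc)
  qed
qed

lemma integrable_sum_measure:
  fixes f :: "'a \<Rightarrow> real"
  assumes sets: "sets N = sets M" and f: "integrable M f" "integrable N f"
  shows "integrable (sum_measure M N) f"
    and "(LINT x|sum_measure M N. f x) = (LINT x|M. f x) + (LINT x|N. f x)"
proof -
  have [measurable]: "f \<in> borel_measurable M"
    using f(1) by simp
  then have [measurable]: "f \<in> borel_measurable (sum_measure M N)"
    by (simp add: measurable_cong_sets[OF sets_sum_measure refl])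
  show int: "integrable (sum_measure M N) f"
    using f by (auto simp: integrable_iff_bounded nn_integral_sum_measure sets)
  have fin: "(\<integral>\<^sup>+ x. ennreal (f x) \<partial>K) < top" "(\<integral>\<^sup>+ x. ennreal (- f x) \<partial>K) < top"
    if "integrable K f" for K
    using that by (auto simp: real_integrable_def less_top)
  show "(LINT x|sum_measure M N. f x) = (LINT x|M. f x) + (LINT x|N. f x)"
    using fin[OF f(1)] fin[OF f(2)]
    by (simp add: real_lebesgue_integral_def int f nn_integral_sum_measure sets enn2real_plus)
qed

lemma sigma_finite_sum_measure:
  assumes "sigma_finite_measure M" "finite_measure N" "sets N = sets M"
  shows "sigma_finite_measure (sum_measure M N)"
proof -
  interpret M: sigma_finite_measure M by fact
  interpret N: finite_measure N by fact
  obtain C where C: "countable C" "C \<subseteq> sets M" "\<Union> C = space M" "\<forall>a\<in>C. emeasure M a \<noteq> \<infinity>"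
    using M.sigma_finite_countable by blast
  have "emeasure (sum_measure M N) a \<noteq> \<infinity>" if "a \<in> C" for a
  proof -
    have "a \<in> sets M" "emeasure M a \<noteq> \<infinity>"
      using that C by blast+
    then show ?thesis
      by (simp add: emeasure_sum_measure assms(3))
  qed
  then show ?thesis
    by (intro sigma_finite_measure.intro exI[of _ C]) (simp add: C)
qed

lemma absolutely_continuous_sum_measure:
  assumes "sets N = sets M"
  shows "absolutely_continuous (sum_measure M N) M"
    and "absolutely_continuous (sum_measure M N) N"
  using assms by (auto simp: absolutely_continuous_def null_sets_def emeasure_sum_measure)

section \<open>The total variation of a difference of measures\<close>

text \<open>
  Sigma-finiteness of the sum is what makes the two Radon--Nikodym derivatives exist. A set where one of
  the measures vanishes, or where the two agree, can then be recognised in the derivatives almost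
  everywhere. The lemmas below turn this into rules for \<open>nn_integral_abs_diff\<close> that no longer mention
  derivatives.
\<close>

locale measures_with_sum =
  fixes M N :: "'a measure"
  assumes sigma_finite: "sigma_finite_measure M" and finite: "finite_measure N"
    and sets_eq [measurable_cong]: "sets N = sets M"
begin

abbreviation "\<rho> \<equiv> sum_measure M N"
abbreviation "p \<equiv> RN_deriv \<rho> M"
abbreviation "q \<equiv> RN_deriv \<rho> N"

sublocale total: sigma_finite_measure \<rho>
  by (rule sigma_finite_sum_measure[OF sigma_finite finite sets_eq])

lemma density_p: "density \<rho> p = M" and density_q: "density \<rho> q = N"
  using absolutely_continuous_sum_measure[OF sets_eq]
  by (simp_all add: total.density_RN_deriv sets_eq)

lemma finite_p: "AE x in \<rho>. p x \<noteq> \<infinity>" and finite_q: "AE x in \<rho>. q x \<noteq> \<infinity>"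
proof -
  interpret N: finite_measure N by (rule finite)
  show "AE x in \<rho>. p x \<noteq> \<infinity>" "AE x in \<rho>. q x \<noteq> \<infinity>"
    using absolutely_continuous_sum_measure[OF sets_eq] sigma_finite
    by (simp_all add: total.RN_deriv_finite sets_eq N.sigma_finite_measure_axioms del: infinity_ennreal_def)
qed

lemma nn_integral_times_density:
  assumes [measurable]: "f \<in> borel_measurable M"
  shows "(\<integral>\<^sup>+ x. f x * p x \<partial>\<rho>) = (\<integral>\<^sup>+ x. f x \<partial>M)"
    and "(\<integral>\<^sup>+ x. f x * q x \<partial>\<rho>) = (\<integral>\<^sup>+ x. f x \<partial>N)"
proof -
  have "(\<integral>\<^sup>+ x. f x \<partial>density \<rho> p) = (\<integral>\<^sup>+ x. f x * p x \<partial>\<rho>)"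
    by (subst nn_integral_density) (auto simp: mult.commute)
  then show "(\<integral>\<^sup>+ x. f x * p x \<partial>\<rho>) = (\<integral>\<^sup>+ x. f x \<partial>M)"
    by (simp add: density_p)
  have "(\<integral>\<^sup>+ x. f x \<partial>density \<rho> q) = (\<integral>\<^sup>+ x. f x * q x \<partial>\<rho>)"
    by (subst nn_integral_density) (auto simp: mult.commute)
  then show "(\<integral>\<^sup>+ x. f x * q x \<partial>\<rho>) = (\<integral>\<^sup>+ x. f x \<partial>N)"
    by (simp add: density_q)
qed

lemma abs_diff_alt:
  "nn_integral_abs_diff M N f = (\<integral>\<^sup>+ x. f x * ennreal \<bar>enn2real (p x) - enn2real (q x)\<bar> \<partial>\<rho>)"
  by (simp add: nn_integral_abs_diff_def Let_def)

lemma abs_diff_add: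
  assumes [measurable]: "f \<in> borel_measurable M" "g \<in> borel_measurable M"
  shows "nn_integral_abs_diff M N (\<lambda>x. f x + g x) =
    nn_integral_abs_diff M N f + nn_integral_abs_diff M N g"
  unfolding abs_diff_alt distrib_right by (intro nn_integral_add) simp_all

text \<open>
  The pointwise bound \<open>\<bar>p - q\<bar> \<le> p + q\<close> also holds where a density is infinite: there the right-hand side is infinite, and
  \<open>enn2real\<close> keeps the left-hand side finite.
\<close>

lemma abs_diff_le:
  assumes [measurable]: "f \<in> borel_measurable M"
  shows "nn_integral_abs_diff M N f \<le> (\<integral>\<^sup>+ x. f x \<partial>M) + (\<integral>\<^sup>+ x. f x \<partial>N)"
proof -
  have le: "ennreal \<bar>enn2real a - enn2real b\<bar> \<le> a + b" for a b :: ennreal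
  proof (cases "a = top \<or> b = top")
    case False
    then have "ennreal \<bar>enn2real a - enn2real b\<bar> \<le> ennreal (enn2real a + enn2real b)"
      using enn2real_nonneg[of a] enn2real_nonneg[of b] by (intro ennreal_leI) linarith
    with False show ?thesis
      by (simp add: ennreal_plus less_top)
  qed auto
  have "nn_integral_abs_diff M N f \<le> (\<integral>\<^sup>+ x. f x * p x + f x * q x \<partial>\<rho>)"
    unfolding abs_diff_alt distrib_left[symmetric] by (intro nn_integral_mono mult_left_mono le) simp
  also have "\<dots> = (\<integral>\<^sup>+ x. f x * p x \<partial>\<rho>) + (\<integral>\<^sup>+ x. f x * q x \<partial>\<rho>)"
    by (intro nn_integral_add) simp_all
  finally show ?thesis
    by (simp add: nn_integral_times_density)
qed

text \<open>
  Since \<open>q = 0\<close> almost everywhere on \<open>E\<close>, \<open>\<bar>p - q\<bar>\<close> is just \<open>p\<close> there.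
\<close>

lemma abs_diff_null_right:
  assumes [measurable]: "f \<in> borel_measurable M" and E [measurable]: "E \<in> sets M"
    and null: "emeasure N E = 0"
  shows "nn_integral_abs_diff M N (\<lambda>x. f x * indicator E x) = (\<integral>\<^sup>+ x\<in>E. f x \<partial>M)"
proof -
  have "(\<integral>\<^sup>+ x. indicator E x * q x \<partial>\<rho>) = 0"
    using null by (simp add: nn_integral_times_density sets_eq)
  then have "AE x in \<rho>. indicator E x * q x = 0"
    by (subst (asm) nn_integral_0_iff_AE) simp_all
  then have "nn_integral_abs_diff M N (\<lambda>x. f x * indicator E x) = (\<integral>\<^sup>+ x. f x * indicator E x * p x \<partial>\<rho>)"
    unfolding abs_diff_alt using finite_p
    by (intro nn_integral_cong_AE) (auto elim!: eventually_elim2 simp: less_top split: split_indicator)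
  then show ?thesis
    by (simp add: nn_integral_times_density)
qed

lemma abs_diff_null_left:
  assumes [measurable]: "f \<in> borel_measurable M" and E [measurable]: "E \<in> sets M"
    and null: "emeasure M E = 0"
  shows "nn_integral_abs_diff M N (\<lambda>x. f x * indicator E x) = (\<integral>\<^sup>+ x\<in>E. f x \<partial>N)"
proof -
  have "(\<integral>\<^sup>+ x. indicator E x * p x \<partial>\<rho>) = 0"
    using null by (simp add: nn_integral_times_density)
  then have "AE x in \<rho>. indicator E x * p x = 0"
    by (subst (asm) nn_integral_0_iff_AE) simp_all
  then have "nn_integral_abs_diff M N (\<lambda>x. f x * indicator E x) = (\<integral>\<^sup>+ x. f x * indicator E x * q x \<partial>\<rho>)"
    unfolding abs_diff_alt using finite_q
    by (intro nn_integral_cong_AE) (auto elim!: eventually_elim2 simp: less_top split: split_indicator)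
  then show ?thesis
    by (simp add: nn_integral_times_density)
qed

text \<open>
  Agreement on all subsets of \<open>E\<close> says that \<open>p\<close> and \<open>q\<close>, cut off to \<open>E\<close>, are densities of the same measure,
  so they coincide almost everywhere by uniqueness of densities.
\<close>

lemma abs_diff_agree:
  assumes E [measurable]: "E \<in> sets M"
    and agree: "\<And>A. A \<in> sets M \<Longrightarrow> emeasure M (A \<inter> E) = emeasure N (A \<inter> E)"
  shows "nn_integral_abs_diff M N (\<lambda>x. f x * indicator E x) = 0"
proof -
  have "density \<rho> (\<lambda>x. indicator E x * p x) = density \<rho> (\<lambda>x. indicator E x * q x)"
  proof (rule measure_eqI)
    fix A assume "A \<in> sets (density \<rho> (\<lambda>x. indicator E x * p x))"
    then have A [measurable]: "A \<in> sets M" by simp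
    have "emeasure (density \<rho> (\<lambda>x. indicator E x * p x)) A = (\<integral>\<^sup>+ x. indicator (A \<inter> E) x * p x \<partial>\<rho>)"
      by (subst emeasure_density) (auto intro!: nn_integral_cong split: split_indicator)
    also have "\<dots> = (\<integral>\<^sup>+ x. indicator (A \<inter> E) x * q x \<partial>\<rho>)"
      using agree[OF A] by (simp add: nn_integral_times_density sets_eq)
    also have "\<dots> = emeasure (density \<rho> (\<lambda>x. indicator E x * q x)) A"
      by (subst emeasure_density) (auto intro!: nn_integral_cong split: split_indicator)
    finally show "emeasure (density \<rho> (\<lambda>x. indicator E x * p x)) A =
      emeasure (density \<rho> (\<lambda>x. indicator E x * q x)) A" .
  qed simp
  then have "AE x in \<rho>. indicator E x * p x = indicator E x * q x"
    by (intro total.density_unique) simp_all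
  then have "nn_integral_abs_diff M N (\<lambda>x. f x * indicator E x) = (\<integral>\<^sup>+ x. 0 \<partial>\<rho>)"
    unfolding abs_diff_alt
    by (intro nn_integral_cong_AE) (auto elim!: eventually_mono split: split_indicator)
  then show ?thesis by simp
qed

end

section \<open>The scheme measure as an image of the original measure\<close>

text \<open>
  The mass \<open>(r\<^sup>2/\<epsilon>\<^sup>2 \<plusminus> r\<^sup>3/\<epsilon>\<^sup>3) / 2\<close> that a point at distance \<open>r \<le> \<epsilon>\<close> from the origin sends to its own radial
  projection on the sphere of radius \<open>\<epsilon>\<close> (\<open>s = 1\<close>) and to the antipode of that projection (\<open>s = -1\<close>).
\<close>

definition radial_weight :: "real \<Rightarrow> real \<Rightarrow> 'a::real_normed_vector \<Rightarrow> real" where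
  "radial_weight \<epsilon> s x =
     (if norm x \<le> \<epsilon> then ((norm x / \<epsilon>)^2 + s * (norm x / \<epsilon>)^3) / 2 else 0)"

lemma radial_weight_measurable [measurable]: "radial_weight \<epsilon> s \<in> borel_measurable borel"
  unfolding radial_weight_def[abs_def] by measurable

text \<open>
  With \<open>t = r/\<epsilon>\<close> the weight is \<open>t\<^sup>2 (1 + s t) / 2\<close> and \<open>t \<le> 1\<close>. This is the reason why the signed
  angular measure is dominated by the positive one.
\<close>

lemma radial_weight_nonneg:
  assumes "\<epsilon> > 0" "\<bar>s\<bar> \<le> 1"
  shows "0 \<le> radial_weight \<epsilon> s x"
proof (cases "norm x \<le> \<epsilon>")
  case True
  define t where "t = norm x / \<epsilon>"
  have t: "0 \<le> t" "t \<le> 1"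
    using True assms(1) by (auto simp: t_def divide_simps)
  have "\<bar>s * t\<bar> \<le> 1 * 1"
    unfolding abs_mult using t assms(2) by (intro mult_mono) auto
  then have "0 \<le> t^2 * (1 + s * t)"
    by (intro mult_nonneg_nonneg) auto
  then show ?thesis
    using True by (simp add: radial_weight_def t_def[symmetric] power2_eq_square power3_eq_cube algebra_simps)
qed (simp add: radial_weight_def)

lemma radial_weight_sum:
  "radial_weight \<epsilon> 1 x + radial_weight \<epsilon> (-1) x = (if norm x \<le> \<epsilon> then (norm x / \<epsilon>)^2 else 0)"
  by (simp add: radial_weight_def field_simps)

lemma radial_weight_diff:
  "radial_weight \<epsilon> 1 x - radial_weight \<epsilon> (-1) x = (if norm x \<le> \<epsilon> then (norm x / \<epsilon>)^3 else 0)"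
  by (simp add: radial_weight_def field_simps)

definition sphere_part :: "(real ^ 'd) measure \<Rightarrow> real \<Rightarrow> real \<Rightarrow> (real ^ 'd) measure" where
  "sphere_part \<nu> \<epsilon> s =
     distr (density \<nu> (\<lambda>x. ennreal (radial_weight \<epsilon> s x))) borel (\<lambda>x. (s * \<epsilon>) *\<^sub>R sgn x)"

definition scheme :: "(real ^ 'd) measure \<Rightarrow> real \<Rightarrow> (real ^ 'd) measure" where
  "scheme \<nu> \<epsilon> = sum_measure (density \<nu> (indicator {x. \<epsilon> < norm x}))
     (sum_measure (sphere_part \<nu> \<epsilon> 1) (sphere_part \<nu> \<epsilon> (-1)))"

lemma nn_integral_sphere_part:
  fixes \<nu> :: "(real ^ 'd) measure"
  assumes [measurable_cong]: "sets \<nu> = sets borel" and [measurable]: "f \<in> borel_measurable borel"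
  shows "(\<integral>\<^sup>+ y. f y \<partial>sphere_part \<nu> \<epsilon> s) =
    (\<integral>\<^sup>+ x. ennreal (radial_weight \<epsilon> s x) * f ((s * \<epsilon>) *\<^sub>R sgn x) \<partial>\<nu>)"
  unfolding sphere_part_def by (simp add: nn_integral_distr nn_integral_density)

lemma integral_sphere_part:
  fixes \<nu> :: "(real ^ 'd) measure" and f :: "real ^ 'd \<Rightarrow> real"
  assumes [measurable_cong]: "sets \<nu> = sets borel" and [measurable]: "f \<in> borel_measurable borel"
    and "\<epsilon> > 0" "\<bar>s\<bar> \<le> 1"
  shows "integrable (sphere_part \<nu> \<epsilon> s) f \<longleftrightarrow>
      integrable \<nu> (\<lambda>x. radial_weight \<epsilon> s x * f ((s * \<epsilon>) *\<^sub>R sgn x))" (is ?int)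
    and "(LINT y|sphere_part \<nu> \<epsilon> s. f y) =
      (LINT x|\<nu>. radial_weight \<epsilon> s x * f ((s * \<epsilon>) *\<^sub>R sgn x))" (is ?eq)
proof -
  have nn: "AE x in \<nu>. 0 \<le> radial_weight \<epsilon> s x"
    using assms by (simp add: radial_weight_nonneg)
  show ?int
    unfolding sphere_part_def
    by (subst integrable_distr_eq) (simp_all add: integrable_density nn)
  show ?eq
    unfolding sphere_part_def
    by (subst integral_distr) (simp_all add: integral_density nn)
qed

lemma sets_sphere_part [simp, measurable_cong]: "sets (sphere_part \<nu> \<epsilon> s) = sets borel"
  by (simp add: sphere_part_def)

lemma sets_scheme [simp]: "sets (scheme \<nu> \<epsilon>) = sets \<nu>"
  by (simp add: scheme_def)

lemma nn_integral_scheme: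
  fixes \<nu> :: "(real ^ 'd) measure"
  assumes sets [measurable_cong]: "sets \<nu> = sets borel" and [measurable]: "f \<in> borel_measurable borel"
  shows "(\<integral>\<^sup>+ y. f y \<partial>scheme \<nu> \<epsilon>) =
    (\<integral>\<^sup>+ x\<in>{x. \<epsilon> < norm x}. f x \<partial>\<nu>) +
    (\<integral>\<^sup>+ x. ennreal (radial_weight \<epsilon> 1 x) * f (\<epsilon> *\<^sub>R sgn x) +
            ennreal (radial_weight \<epsilon> (-1) x) * f (- \<epsilon> *\<^sub>R sgn x) \<partial>\<nu>)"
  unfolding scheme_def
  by (simp add: nn_integral_sum_measure nn_integral_density nn_integral_sphere_part sets
      nn_integral_add mult.commute)

text \<open>
  A radial function does not distinguish a point of the sphere from its antipode, so only the sum
  \<open>r\<^sup>2/\<epsilon>\<^sup>2\<close> of the two weights matters. This gives the total mass (\<open>g = 1\<close>), the absence of mass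
  inside the ball and the fourth moment on the sphere.
\<close>

lemma nn_integral_scheme_radial:
  fixes \<nu> :: "(real ^ 'd) measure"
  assumes sets [measurable_cong]: "sets \<nu> = sets borel" and eps: "\<epsilon> > 0"
    and [measurable]: "g \<in> borel_measurable borel"
  shows "(\<integral>\<^sup>+ y. g (norm y) \<partial>scheme \<nu> \<epsilon>) =
    (\<integral>\<^sup>+ x\<in>{x. \<epsilon> < norm x}. g (norm x) \<partial>\<nu>) +
    g \<epsilon> * ennreal (1 / \<epsilon>\<^sup>2) * (\<integral>\<^sup>+ x\<in>{x. norm x \<le> \<epsilon>}. ennreal ((norm x)\<^sup>2) \<partial>\<nu>)"
proof -
  have "ennreal (radial_weight \<epsilon> 1 x) * g (norm (\<epsilon> *\<^sub>R sgn x)) +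
      ennreal (radial_weight \<epsilon> (-1) x) * g (norm (- \<epsilon> *\<^sub>R sgn x)) =
      g \<epsilon> * ennreal (1 / \<epsilon>\<^sup>2) * (ennreal ((norm x)\<^sup>2) * indicator {x. norm x \<le> \<epsilon>} x)"
    for x :: "real ^ 'd"
  proof (cases "x = 0")
    case False
    then have "ennreal (radial_weight \<epsilon> 1 x) * g (norm (\<epsilon> *\<^sub>R sgn x)) +
      ennreal (radial_weight \<epsilon> (-1) x) * g (norm (- \<epsilon> *\<^sub>R sgn x)) =
      g \<epsilon> * (ennreal (radial_weight \<epsilon> 1 x) + ennreal (radial_weight \<epsilon> (-1) x))"
      using eps by (simp add: norm_sgn algebra_simps)
    also have "ennreal (radial_weight \<epsilon> 1 x) + ennreal (radial_weight \<epsilon> (-1) x) =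
        ennreal (radial_weight \<epsilon> 1 x + radial_weight \<epsilon> (-1) x)"
      using eps by (simp add: radial_weight_nonneg)
    also have "\<dots> = ennreal (1 / \<epsilon>\<^sup>2) * (ennreal ((norm x)\<^sup>2) * indicator {x. norm x \<le> \<epsilon>} x)"
      unfolding radial_weight_sum
      by (auto simp: ennreal_mult[symmetric] power_divide split: split_indicator)
    finally show ?thesis by (simp add: mult.assoc)
  qed (use eps in \<open>simp add: radial_weight_def\<close>)
  then show ?thesis
    by (subst nn_integral_scheme) (simp_all add: sets nn_integral_cmult)
qed

lemma emeasure_scheme:
  fixes \<nu> :: "(real ^ 'd) measure"
  assumes sets [measurable_cong]: "sets \<nu> = sets borel" and B [measurable]: "B \<in> sets borel"
  shows "emeasure (scheme \<nu> \<epsilon>) B =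
    emeasure \<nu> {x \<in> B. \<epsilon> < norm x} +
    (\<integral>\<^sup>+ x. ennreal (radial_weight \<epsilon> 1 x) * indicator B (\<epsilon> *\<^sub>R sgn x) +
            ennreal (radial_weight \<epsilon> (-1) x) * indicator B (- \<epsilon> *\<^sub>R sgn x) \<partial>\<nu>)"
proof -
  have "(\<integral>\<^sup>+ x\<in>{x. \<epsilon> < norm x}. indicator B x \<partial>\<nu>) = (\<integral>\<^sup>+ x. indicator {x \<in> B. \<epsilon> < norm x} x \<partial>\<nu>)"
    by (intro nn_integral_cong) (auto split: split_indicator)
  then show ?thesis
    using nn_integral_scheme[OF sets, of "indicator B" \<epsilon>] by (simp add: sets)
qed

section \<open>Preservation of the second and third moments\<close>

text \<open>
  Moving \<open>x\<close> to \<open>\<plusminus>\<epsilon> x / r\<close> multiplies a function that is homogeneous of degree \<open>n\<close> by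
  \<open>(\<plusminus>1)\<^sup>n (\<epsilon>/r)\<^sup>n\<close>. The two weights, combined with the sign \<open>(-1)\<^sup>n\<close>, give their sum \<open>(r/\<epsilon>)\<^sup>2\<close> for
  \<open>n = 2\<close> and their difference \<open>(r/\<epsilon>)\<^sup>3\<close> for \<open>n = 3\<close>, which compensates the factor exactly. The
  moment is thus preserved pointwise, before integration.
\<close>

lemma homogeneous_moment:
  fixes \<nu> :: "(real ^ 'd) measure" and f :: "real ^ 'd \<Rightarrow> real"
  assumes sets [measurable_cong]: "sets \<nu> = sets borel" and [measurable]: "f \<in> borel_measurable borel"
    and eps: "\<epsilon> > 0"
    and n: "n = 2 \<or> n = 3" and hom: "\<And>c x. f (c *\<^sub>R x) = c ^ n * f x"
    and le: "\<And>x. \<bar>f x\<bar> \<le> norm x ^ n"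
    and int: "integrable \<nu> (\<lambda>x. (norm x)\<^sup>2)" "integrable \<nu> (\<lambda>x. norm x ^ n)"
  shows "integrable (scheme \<nu> \<epsilon>) f" and "(LINT x|scheme \<nu> \<epsilon>. f x) = (LINT x|\<nu>. f x)"
proof -
  define w where "w s x = radial_weight \<epsilon> s x * f ((s * \<epsilon>) *\<^sub>R sgn x)" for s x
  have f_sgn: "f ((s * \<epsilon>) *\<^sub>R sgn x) = s ^ n * (\<epsilon> / norm x) ^ n * f x" for s x
    using hom[of "s * \<epsilon> / norm x" x]
    by (simp add: sgn_div_norm divide_inverse power_mult_distrib mult.assoc)
  have w_sum: "w 1 x + w (-1) x = f x * indicator {x. norm x \<le> \<epsilon>} x" for x
  proof (cases "x = 0")
    case True
    have "f 0 = 0"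
      using hom[of 0 0] n by auto
    with True show ?thesis by (simp add: w_def)
  next
    case False
    have "w 1 x + w (-1) x =
        (radial_weight \<epsilon> 1 x + (-1) ^ n * radial_weight \<epsilon> (-1) x) * (\<epsilon> / norm x) ^ n * f x"
      unfolding w_def f_sgn by (simp add: algebra_simps)
    also have "radial_weight \<epsilon> 1 x + (-1) ^ n * radial_weight \<epsilon> (-1) x =
        (norm x / \<epsilon>) ^ n * indicator {x. norm x \<le> \<epsilon>} x"
      using n radial_weight_sum[of \<epsilon> x] radial_weight_diff[of \<epsilon> x] by auto
    finally show ?thesis
      using False eps by (simp add: power_divide)
  qed
  \<comment> \<open>Each projected term needs its own integrable bound. For \<open>n = 3\<close> it is not dominated by a multiple of
    \<open>\<bar>f\<bar>\<close>, which may be of order \<open>r\<^sup>3\<close> near the origin where the term is of order \<open>r\<^sup>2\<close>.\<close>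
  have w_le: "norm (w s x) \<le> norm (\<epsilon> ^ n / \<epsilon>\<^sup>2 * (norm x)\<^sup>2)" if s: "s = 1 \<or> s = -1" for s x
  proof -
    have nn: "0 \<le> radial_weight \<epsilon> s x"
      using eps s by (intro radial_weight_nonneg) auto
    have "radial_weight \<epsilon> s x \<le> (if norm x \<le> \<epsilon> then (norm x / \<epsilon>)\<^sup>2 else 0)"
      using radial_weight_sum[of \<epsilon> x] radial_weight_nonneg[OF eps, of 1 x]
        radial_weight_nonneg[OF eps, of "-1" x] s by auto
    also have "\<dots> \<le> (norm x)\<^sup>2 / \<epsilon>\<^sup>2"
      by (simp add: power_divide)
    finally have "radial_weight \<epsilon> s x \<le> (norm x)\<^sup>2 / \<epsilon>\<^sup>2" .
    moreover have "\<bar>f ((s * \<epsilon>) *\<^sub>R sgn x)\<bar> \<le> \<epsilon> ^ n"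
    proof -
      have "norm ((s * \<epsilon>) *\<^sub>R sgn x) \<le> \<epsilon>"
        using s eps by (auto simp: norm_sgn)
      then show ?thesis
        using le[of "(s * \<epsilon>) *\<^sub>R sgn x"] power_mono[OF _ norm_ge_zero, of "(s * \<epsilon>) *\<^sub>R sgn x" \<epsilon> n]
        by linarith
    qed
    ultimately have "\<bar>w s x\<bar> \<le> ((norm x)\<^sup>2 / \<epsilon>\<^sup>2) * \<epsilon> ^ n"
      unfolding w_def abs_mult using nn by (intro mult_mono) auto
    then show ?thesis
      using eps by (simp add: mult.commute)
  qed
  have [measurable]: "w s \<in> borel_measurable borel" for s
    unfolding w_def[abs_def] by measurable
  have int_w: "integrable \<nu> (w s)" if s: "s = 1 \<or> s = -1" for s
  proof (rule Bochner_Integration.integrable_bound)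
    show "integrable \<nu> (\<lambda>x. \<epsilon> ^ n / \<epsilon>\<^sup>2 * (norm x)\<^sup>2)"
      by (intro integrable_mult_right int)
    show "w s \<in> borel_measurable \<nu>"
      by measurable
  qed (rule AE_I2, rule w_le[OF s])
  have int_f: "integrable \<nu> f"
  proof (rule Bochner_Integration.integrable_bound[OF int(2)])
    show "AE x in \<nu>. norm (f x) \<le> norm (norm x ^ n)"
      using le by simp
  qed measurable
  define E where "E = {x :: real ^ 'd. \<epsilon> < norm x}"
  have E [measurable]: "E \<in> sets borel"
    unfolding E_def by measurable
  have int_E: "integrable \<nu> (\<lambda>x. indicator E x * f x)"
    using integrable_mult_indicator[OF _ int_f, of E] E by (simp add: sets)
  have ind: "density \<nu> (indicator E) = density \<nu> (\<lambda>x. ennreal (indicator E x))"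
    by (simp add: ennreal_indicator)
  have outer: "integrable (density \<nu> (indicator E)) f"
    "(LINT x|density \<nu> (indicator E). f x) = (LINT x|\<nu>. indicator E x * f x)"
    unfolding ind using int_E by (simp_all add: integrable_density integral_density)
  have sphere: "integrable (sphere_part \<nu> \<epsilon> s) f" "(LINT x|sphere_part \<nu> \<epsilon> s. f x) = (LINT x|\<nu>. w s x)"
    if s: "s = 1 \<or> s = -1" for s
  proof -
    have "\<bar>s\<bar> \<le> 1"
      using s by auto
    from integral_sphere_part[OF sets _ eps this, of f] int_w[OF s]
    show "integrable (sphere_part \<nu> \<epsilon> s) f" "(LINT x|sphere_part \<nu> \<epsilon> s. f x) = (LINT x|\<nu>. w s x)"
      unfolding w_def by simp_all
  qed
  let ?S = "sum_measure (sphere_part \<nu> \<epsilon> 1) (sphere_part \<nu> \<epsilon> (-1))"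
  have inner: "integrable ?S f" "(LINT x|?S. f x) = (LINT x|\<nu>. w 1 x) + (LINT x|\<nu>. w (-1) x)"
    using integrable_sum_measure[OF _ sphere(1)[of 1] sphere(1)[of "-1"]] sphere(2)[of 1] sphere(2)[of "-1"]
    by simp_all
  have sets_eq: "sets ?S = sets (density \<nu> (indicator E))"
    by (simp add: sets)
  show "integrable (scheme \<nu> \<epsilon>) f"
    unfolding scheme_def E_def[symmetric]
    by (rule integrable_sum_measure(1)[OF sets_eq outer(1) inner(1)])
  have "(LINT x|scheme \<nu> \<epsilon>. f x) =
      (LINT x|\<nu>. indicator E x * f x) + ((LINT x|\<nu>. w 1 x) + (LINT x|\<nu>. w (-1) x))"
    unfolding scheme_def E_def[symmetric] integrable_sum_measure(2)[OF sets_eq outer(1) inner(1)]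
    by (simp only: inner(2) outer(2))
  also have "\<dots> = (LINT x|\<nu>. indicator E x * f x + (w 1 x + w (-1) x))"
    using int_E int_w[of 1] int_w[of "-1"] by simp
  also have "\<dots> = (LINT x|\<nu>. f x)"
    unfolding w_sum E_def
    by (intro Bochner_Integration.integral_cong) (auto split: split_indicator)
  finally show "(LINT x|scheme \<nu> \<epsilon>. f x) = (LINT x|\<nu>. f x)" .
qed

section \<open>Identification with the three-moment measure\<close>

lemma integral_spherical:
  fixes \<nu> :: "(real ^ 'd) measure" and A :: "(real ^ 'd) set" and g :: "real \<Rightarrow> real"
  assumes [measurable_cong]: "sets \<nu> = sets borel" and [measurable]: "A \<in> sets borel" "g \<in> borel_measurable borel"
  shows "(LINT z:{0..\<epsilon>} \<times> A|spherical \<nu>. g (fst z)) =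
      (LINT x|\<nu>. (if norm x \<le> \<epsilon> then g (norm x) else 0) * indicator A (sgn x))"
    and "(LINT z:{0..\<epsilon>} \<times> A|spherical (reflection \<nu>). g (fst z)) =
      (LINT x|\<nu>. (if norm x \<le> \<epsilon> then g (norm x) else 0) * indicator A (- sgn x))"
proof -
  have [measurable]: "(\<lambda>x :: real ^ 'd. (norm x, s *\<^sub>R sgn x)) \<in> borel \<rightarrow>\<^sub>M borel \<Otimes>\<^sub>M borel" for s :: real
    by measurable
  \<comment> \<open>The angle \<open>s x / r\<close> covers the measure itself (\<open>s = 1\<close>) and its reflection (\<open>s = -1\<close>).\<close>
  have "(LINT z:{0..\<epsilon>} \<times> A|distr \<nu> (borel \<Otimes>\<^sub>M borel) (\<lambda>x. (norm x, s *\<^sub>R sgn x)). g (fst z)) =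
      (LINT x|\<nu>. (if norm x \<le> \<epsilon> then g (norm x) else 0) * indicator A (s *\<^sub>R sgn x))" for s :: real
    unfolding set_lebesgue_integral_def
    by (subst integral_distr) (auto intro!: Bochner_Integration.integral_cong split: split_indicator)
  note this[of 1] this[of "-1"]
  moreover have "spherical \<nu> = distr \<nu> (borel \<Otimes>\<^sub>M borel) (\<lambda>x. (norm x, 1 *\<^sub>R sgn x))"
    by (simp add: spherical_def)
  moreover have "spherical (reflection \<nu>) = distr \<nu> (borel \<Otimes>\<^sub>M borel) (\<lambda>x. (norm x, (-1) *\<^sub>R sgn x))"
    unfolding spherical_def reflection_def
    by (subst distr_distr) (simp_all add: comp_def sgn_minus)
  ultimately show "(LINT z:{0..\<epsilon>} \<times> A|spherical \<nu>. g (fst z)) =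
      (LINT x|\<nu>. (if norm x \<le> \<epsilon> then g (norm x) else 0) * indicator A (sgn x))"
    "(LINT z:{0..\<epsilon>} \<times> A|spherical (reflection \<nu>). g (fst z)) =
      (LINT x|\<nu>. (if norm x \<le> \<epsilon> then g (norm x) else 0) * indicator A (- sgn x))"
    by simp_all
qed

text \<open>
  The even angular measure collects the terms in \<open>r\<^sup>2\<close>, the odd one those in \<open>r\<^sup>3\<close>. Collecting instead what
  the original measure and what its reflection contributes produces the two radial weights. The right-hand
  side is an honest measure, so this identity contains the positivity of the charge.
\<close>

lemma three_moment_charge_eq_emeasure_scheme:
  fixes \<nu> :: "(real ^ 'd) measure"
  assumes sets [measurable_cong]: "sets \<nu> = sets borel" and B [measurable]: "B \<in> sets borel"
    and eps: "\<epsilon> > 0" and int: "integrable \<nu> (\<lambda>x. (norm x)\<^sup>2)"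
  shows "three_moment_charge \<nu> \<epsilon> B = enn2ereal (emeasure (scheme \<nu> \<epsilon>) B)"
proof -
  define A where "A = {\<theta> \<in> sphere 0 1. \<epsilon> *\<^sub>R \<theta> \<in> B}"
  have A [measurable]: "A \<in> sets borel"
  proof -
    have "{\<theta> \<in> space borel. \<epsilon> *\<^sub>R \<theta> \<in> B} \<in> sets borel"
      by measurable
    moreover have "A = sphere 0 1 \<inter> {\<theta> \<in> space borel. \<epsilon> *\<^sub>R \<theta> \<in> B}"
      by (auto simp: A_def)
    ultimately show ?thesis
      by (auto intro!: sets.Int borel_closed)
  qed
  define I :: "nat \<Rightarrow> real \<Rightarrow> real ^ 'd \<Rightarrow> real" where
    "I k s x = (if norm x \<le> \<epsilon> then norm x ^ k / \<epsilon> ^ k else 0) * indicator A (s *\<^sub>R sgn x)" for k s x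
  have int_I: "integrable \<nu> (I k s)" if "k \<ge> 2" for k s
  proof (rule Bochner_Integration.integrable_bound)
    show "integrable \<nu> (\<lambda>x. (norm x)\<^sup>2 / \<epsilon>\<^sup>2)"
      by (intro integrable_divide int)
    show "I k s \<in> borel_measurable \<nu>"
      unfolding I_def[abs_def] by measurable
    have "norm (I k s x) \<le> norm ((norm x)\<^sup>2 / \<epsilon>\<^sup>2)" for x
    proof (cases "norm x \<le> \<epsilon>")
      case True
      then have "(norm x / \<epsilon>) ^ k \<le> (norm x / \<epsilon>)\<^sup>2"
        using eps that by (intro power_decreasing) auto
      then show ?thesis
        using eps by (auto simp: I_def power_divide split: split_indicator)
    qed (simp add: I_def)
    then show "AE x in \<nu>. norm (I k s x) \<le> norm ((norm x)\<^sup>2 / \<epsilon>\<^sup>2)"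
      by simp
  qed
  define F where "F x = radial_weight \<epsilon> 1 x * indicator B (\<epsilon> *\<^sub>R sgn x) +
    radial_weight \<epsilon> (-1) x * indicator B (- \<epsilon> *\<^sub>R sgn x)" for x :: "real ^ 'd"
  \<comment> \<open>At the origin \<open>sgn x = 0\<close> is not on the sphere and \<open>\<epsilon> *\<^sub>R sgn x\<close> may lie in \<open>B\<close>, but all weights vanish there.\<close>
  have F_eq: "F x = 1/2 * (I 2 1 x + I 2 (-1) x) + 1/2 * (I 3 1 x - I 3 (-1) x)" for x
  proof (cases "x = 0")
    case False
    then have "indicator A (sgn x) = (indicator B (\<epsilon> *\<^sub>R sgn x) :: real)"
      "indicator A (- sgn x) = (indicator B (- (\<epsilon> *\<^sub>R sgn x)) :: real)"
      by (auto simp: A_def norm_sgn split: split_indicator)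
    then show ?thesis
      unfolding F_def I_def radial_weight_def by (simp add: power_divide field_simps)
  qed (simp add: F_def I_def radial_weight_def)
  have even_odd: "angular_even \<nu> \<epsilon> A + angular_odd \<nu> \<epsilon> A = (LINT x|\<nu>. F x)"
  proof -
    have g: "(\<lambda>r. r ^ k / \<epsilon> ^ k) \<in> borel_measurable borel" for k
      by measurable
    have spherical: "(LINT z:{0..\<epsilon>} \<times> A|spherical \<nu>. fst z ^ k / \<epsilon> ^ k) = (LINT x|\<nu>. I k 1 x)"
      "(LINT z:{0..\<epsilon>} \<times> A|spherical (reflection \<nu>). fst z ^ k / \<epsilon> ^ k) = (LINT x|\<nu>. I k (-1) x)" for k
      unfolding integral_spherical[OF sets A g] by (simp_all add: I_def)
    have "(LINT x|\<nu>. F x) = 1/2 * ((LINT x|\<nu>. I 2 1 x) + (LINT x|\<nu>. I 2 (-1) x)) +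
        1/2 * ((LINT x|\<nu>. I 3 1 x) - (LINT x|\<nu>. I 3 (-1) x))"
      unfolding F_eq by (simp add: int_I)
    then show ?thesis
      unfolding angular_even_def angular_odd_def spherical by simp
  qed
  have F_nonneg: "0 \<le> F x" for x
    unfolding F_def using eps by (intro add_nonneg_nonneg mult_nonneg_nonneg radial_weight_nonneg) auto
  have int_F: "integrable \<nu> F"
    unfolding F_eq[abs_def] using int_I by simp
  have "ereal (LINT x|\<nu>. F x) = enn2ereal (\<integral>\<^sup>+ x. ennreal (F x) \<partial>\<nu>)"
    using F_nonneg by (simp add: nn_integral_eq_integral[OF int_F] enn2ereal_ennreal)
  moreover have "ennreal (F x) = ennreal (radial_weight \<epsilon> 1 x) * indicator B (\<epsilon> *\<^sub>R sgn x) +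
      ennreal (radial_weight \<epsilon> (-1) x) * indicator B (- \<epsilon> *\<^sub>R sgn x)" for x
    using eps by (auto simp: F_def radial_weight_nonneg split: split_indicator)
  ultimately show ?thesis
    unfolding three_moment_charge_def emeasure_scheme[OF sets B] A_def[symmetric] even_odd
    by (simp add: plus_ennreal.rep_eq)
qed

lemma three_moment_measure_eq_scheme:
  fixes \<nu> :: "(real ^ 'd) measure"
  assumes sets: "sets \<nu> = sets borel" and eps: "\<epsilon> > 0" and int: "integrable \<nu> (\<lambda>x. (norm x)\<^sup>2)"
  shows "three_moment_measure \<nu> \<epsilon> = scheme \<nu> \<epsilon>"
proof -
  have sp: "space (scheme \<nu> \<epsilon>) = UNIV"
    using sets_eq_imp_space_eq[of "scheme \<nu> \<epsilon>" borel] sets by simp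
  have ss: "sigma_sets UNIV (sets borel) = (sets borel :: (real ^ 'd) set set)"
    using sets.sigma_sets_eq[of "borel :: (real ^ 'd) measure"] by simp
  have "three_moment_measure \<nu> \<epsilon> = measure_of UNIV (sets borel) (emeasure (scheme \<nu> \<epsilon>))"
    unfolding three_moment_measure_def
    by (rule measure_of_eq)
      (auto simp: ss three_moment_charge_eq_emeasure_scheme[OF sets _ eps int] e2ennreal_enn2ereal)
  also have "\<dots> = scheme \<nu> \<epsilon>"
    using measure_of_of_measure[of "scheme \<nu> \<epsilon>"] by (simp add: sp sets)
  finally show ?thesis .
qed

section \<open>Integrability for a Levy measure\<close>

lemma emeasure_outside_ball_finite:
  fixes \<nu> :: "(real ^ 'd) measure"
  assumes sets [measurable_cong]: "sets \<nu> = sets borel" and int: "integrable \<nu> (\<lambda>x. (norm x)\<^sup>2)" and c: "c > 0"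
  shows "emeasure \<nu> {x. c < norm x} < \<infinity>"
proof -
  have "emeasure \<nu> {x. c < norm x} = (\<integral>\<^sup>+ x. indicator {x. c < norm x} x \<partial>\<nu>)"
    by (simp add: sets)
  also have "\<dots> \<le> (\<integral>\<^sup>+ x. ennreal ((norm x)\<^sup>2 / c\<^sup>2) \<partial>\<nu>)"
  proof (rule nn_integral_mono)
    fix x :: "real ^ 'd"
    have "1 \<le> (norm x)\<^sup>2 / c\<^sup>2" if "c < norm x"
      using that c by (simp add: power_mono)
    then show "indicator {x. c < norm x} x \<le> ennreal ((norm x)\<^sup>2 / c\<^sup>2)"
      by (simp split: split_indicator)
  qed
  also have "\<dots> < \<infinity>"
    using integrable_divide[OF int, of "c\<^sup>2"] by (simp add: integrable_iff_bounded)
  finally show ?thesis .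
qed

text \<open>
  The complements of the balls of radius \<open>1 / (n + 1)\<close> have finite mass. They miss only the origin, which
  is a null set.
\<close>

lemma levy_sigma_finite:
  fixes \<nu> :: "(real ^ 'd) measure"
  assumes levy: "levy_measure \<nu>" and int: "integrable \<nu> (\<lambda>x. (norm x)\<^sup>2)"
  shows "sigma_finite_measure \<nu>"
proof (intro sigma_finite_measure.intro exI conjI ballI)
  have sets [measurable_cong]: "sets \<nu> = sets borel" and zero: "emeasure \<nu> {0} = 0"
    using levy by (simp_all add: levy_measure_def)
  let ?C = "insert {0} (range (\<lambda>n. {x :: real ^ 'd. 1 / Suc n < norm x}))"
  show "countable ?C" by simp
  show "?C \<subseteq> sets \<nu>" by (auto simp: sets)
  have "\<exists>n. 1 / Suc n < norm x" if "x \<noteq> 0" for x :: "real ^ 'd"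
    using that nat_approx_posE[of "norm x"] by (metis zero_less_norm_iff)
  then show "\<Union> ?C = space \<nu>"
    using sets_eq_imp_space_eq[OF sets] by auto
  show "emeasure \<nu> a \<noteq> \<infinity>" if a: "a \<in> ?C" for a
  proof -
    consider "a = {0}" | n :: nat where "a = {x. 1 / Suc n < norm x}"
      using a by blast
    then show ?thesis
    proof cases
      case (2 n)
      have "emeasure \<nu> {x. 1 / Suc n < norm x} < \<infinity>"
        by (rule emeasure_outside_ball_finite[OF sets int]) simp
      with 2 show ?thesis by simp
    qed (simp add: zero)
  qed
qed

text \<open>
  Near the origin \<open>r\<^sup>n \<le> r\<^sup>2\<close>, which the Levy condition controls; far away \<open>r\<^sup>n \<le> r\<^sup>3\<close>.
\<close>

lemma levy_integrable_power:
  fixes \<nu> :: "(real ^ 'd) measure"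
  assumes levy: "levy_measure \<nu>" and third: "(\<integral>\<^sup>+ x. ennreal ((norm x)^3) \<partial>\<nu>) < \<infinity>"
    and n: "n = 2 \<or> n = 3"
  shows "integrable \<nu> (\<lambda>x. norm x ^ n)"
proof (rule integrableI_bounded)
  have sets [measurable_cong]: "sets \<nu> = sets borel" and fin: "(\<integral>\<^sup>+ x. ennreal (min 1 ((norm x)\<^sup>2)) \<partial>\<nu>) < \<infinity>"
    using levy by (simp_all add: levy_measure_def)
  show "(\<lambda>x. norm x ^ n) \<in> borel_measurable \<nu>"
    by measurable
  have "t ^ n \<le> min 1 (t\<^sup>2) + t ^ 3" if "t \<ge> 0" for t :: real
  proof (cases "t \<le> 1")
    case True
    then have "t\<^sup>2 \<le> 1"
      using that by (intro power_le_one)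
    then show ?thesis
      using n that by (auto simp: min_absorb2)
  next
    case False
    then have "t ^ n \<le> t ^ 3"
      using n by (intro power_increasing) auto
    then show ?thesis
      using that by (simp add: min_def add_increasing)
  qed
  then have "(\<integral>\<^sup>+ x. ennreal (norm (norm x ^ n)) \<partial>\<nu>) \<le>
      (\<integral>\<^sup>+ x. ennreal (min 1 ((norm x)\<^sup>2)) + ennreal ((norm x)^3) \<partial>\<nu>)"
    by (intro nn_integral_mono) (simp add: ennreal_plus[symmetric] del: ennreal_plus)
  also have "\<dots> = (\<integral>\<^sup>+ x. ennreal (min 1 ((norm x)\<^sup>2)) \<partial>\<nu>) + (\<integral>\<^sup>+ x. ennreal ((norm x)^3) \<partial>\<nu>)"
    by (intro nn_integral_add) simp_all
  also have "\<dots> < \<infinity>"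
    using fin third by simp
  finally show "(\<integral>\<^sup>+ x. ennreal (norm (norm x ^ n)) \<partial>\<nu>) < \<infinity>" .
qed

section \<open>The fourth moment of the total variation\<close>

text \<open>
  The two measures agree outside the closed ball, and the scheme measure vanishes inside the open ball.
  On the sphere of radius \<open>\<epsilon>\<close> the original measure and the projected mass may overlap and partly cancel.
  This is the only place where the bound can be strict.
\<close>

lemma abs_diff_scheme:
  fixes \<nu> :: "(real ^ 'd) measure"
  assumes levy: "levy_measure \<nu>" and eps: "\<epsilon> > 0" and int: "integrable \<nu> (\<lambda>x. (norm x)\<^sup>2)"
    and fin: "finite_measure (scheme \<nu> \<epsilon>)"
  defines "bound \<equiv> (\<integral>\<^sup>+ x\<in>{x. norm x \<le> \<epsilon>}. ennreal ((norm x)^4) \<partial>\<nu>) +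
      ennreal (\<epsilon>\<^sup>2) * (\<integral>\<^sup>+ x\<in>{x. norm x \<le> \<epsilon>}. ennreal ((norm x)\<^sup>2) \<partial>\<nu>)"
  shows "nn_integral_abs_diff \<nu> (scheme \<nu> \<epsilon>) (\<lambda>x. ennreal ((norm x)^4)) \<le> bound"
    and "emeasure \<nu> {x. norm x = \<epsilon>} = 0 \<Longrightarrow>
      nn_integral_abs_diff \<nu> (scheme \<nu> \<epsilon>) (\<lambda>x. ennreal ((norm x)^4)) = bound"
proof -
  have sets [measurable_cong]: "sets \<nu> = sets borel"
    using levy by (simp add: levy_measure_def)
  interpret measures_with_sum \<nu> "scheme \<nu> \<epsilon>"
    by (rule measures_with_sum.intro[OF levy_sigma_finite[OF levy int] fin]) simp
  let ?N = "scheme \<nu> \<epsilon>"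
  define f where "f x = ennreal ((norm x)^4)" for x :: "real ^ 'd"
  define Out where "Out = {x :: real ^ 'd. \<epsilon> < norm x}"
  define In where "In = {x :: real ^ 'd. norm x < \<epsilon>}"
  define S where "S = {x :: real ^ 'd. norm x = \<epsilon>}"
  have f [measurable]: "f \<in> borel_measurable \<nu>"
    unfolding f_def[abs_def] by measurable
  have Out [measurable]: "Out \<in> sets \<nu>" and In [measurable]: "In \<in> sets \<nu>" and S [measurable]: "S \<in> sets \<nu>"
    by (simp_all add: Out_def In_def S_def sets)
  have outer: "nn_integral_abs_diff \<nu> ?N (\<lambda>x. f x * indicator Out x) = 0"
  proof (rule abs_diff_agree[OF Out])
    fix A assume A: "A \<in> sets \<nu>"
    have "norm (\<epsilon> *\<^sub>R sgn x) \<le> \<epsilon>" for x :: "real ^ 'd"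
      using eps by (simp add: norm_sgn)
    then have "indicator (A \<inter> Out) (\<epsilon> *\<^sub>R sgn x) = (0 :: ennreal)"
      "indicator (A \<inter> Out) (- \<epsilon> *\<^sub>R sgn x) = (0 :: ennreal)" for x
      by (auto simp: Out_def not_less split: split_indicator)
    moreover have "A \<inter> Out \<in> sets borel"
      using A Out sets by auto
    moreover have "{x \<in> A \<inter> Out. \<epsilon> < norm x} = A \<inter> Out"
      by (auto simp: Out_def)
    ultimately show "emeasure \<nu> (A \<inter> Out) = emeasure ?N (A \<inter> Out)"
      by (simp add: emeasure_scheme[OF sets])
  qed
  have "emeasure ?N In = (\<integral>\<^sup>+ y. indicator {..<\<epsilon>} (norm y) \<partial>?N)"
  proof -
    have "emeasure ?N In = (\<integral>\<^sup>+ y. indicator In y \<partial>?N)"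
      using In by simp
    also have "\<dots> = (\<integral>\<^sup>+ y. indicator {..<\<epsilon>} (norm y) \<partial>?N)"
      by (intro nn_integral_cong) (simp add: In_def indicator_def)
    finally show ?thesis .
  qed
  also have "\<dots> = 0"
  proof -
    have "(\<integral>\<^sup>+ x\<in>{x. \<epsilon> < norm x}. indicator {..<\<epsilon>} (norm x) \<partial>\<nu>) = (\<integral>\<^sup>+ x. 0 \<partial>\<nu>)"
      by (intro nn_integral_cong) (auto split: split_indicator)
    then show ?thesis
      by (subst nn_integral_scheme_radial[OF sets eps]) simp_all
  qed
  finally have inner: "nn_integral_abs_diff \<nu> ?N (\<lambda>x. f x * indicator In x) = (\<integral>\<^sup>+ x\<in>In. f x \<partial>\<nu>)"
    by (intro abs_diff_null_right f In)
  have sphere: "(\<integral>\<^sup>+ x\<in>S. f x \<partial>?N) =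
      ennreal (\<epsilon>\<^sup>2) * (\<integral>\<^sup>+ x\<in>{x. norm x \<le> \<epsilon>}. ennreal ((norm x)\<^sup>2) \<partial>\<nu>)" (is "_ = ?moment")
  proof -
    define g where "g t = ennreal (t ^ 4) * indicator {\<epsilon>} t" for t :: real
    have g: "g \<in> borel_measurable borel"
      unfolding g_def[abs_def] by measurable
    have "(\<integral>\<^sup>+ x\<in>S. f x \<partial>?N) = (\<integral>\<^sup>+ y. g (norm y) \<partial>?N)"
      by (intro nn_integral_cong) (simp add: f_def g_def S_def indicator_def)
    also have "\<dots> = (\<integral>\<^sup>+ x\<in>{x. \<epsilon> < norm x}. g (norm x) \<partial>\<nu>) +
        g \<epsilon> * ennreal (1 / \<epsilon>\<^sup>2) * (\<integral>\<^sup>+ x\<in>{x. norm x \<le> \<epsilon>}. ennreal ((norm x)\<^sup>2) \<partial>\<nu>)"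
      by (rule nn_integral_scheme_radial[OF sets eps g])
    also have "(\<integral>\<^sup>+ x\<in>{x. \<epsilon> < norm x}. g (norm x) \<partial>\<nu>) = (\<integral>\<^sup>+ x. 0 \<partial>\<nu>)"
      by (intro nn_integral_cong) (auto simp: g_def split: split_indicator)
    also have "g \<epsilon> * ennreal (1 / \<epsilon>\<^sup>2) = ennreal (\<epsilon> ^ 4 * (1 / \<epsilon>\<^sup>2))"
      using eps by (simp add: g_def ennreal_mult[symmetric])
    also have "\<epsilon> ^ 4 * (1 / \<epsilon>\<^sup>2) = \<epsilon>\<^sup>2"
      using eps by (simp add: field_simps flip: power_add)
    finally show ?thesis by simp
  qed
  have "f = (\<lambda>x. f x * indicator Out x + (f x * indicator In x + f x * indicator S x))"
    by (auto simp: fun_eq_iff Out_def In_def S_def split: split_indicator)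
  then have "nn_integral_abs_diff \<nu> ?N f =
      nn_integral_abs_diff \<nu> ?N (\<lambda>x. f x * indicator Out x + (f x * indicator In x + f x * indicator S x))"
    by simp
  also have "\<dots> = (\<integral>\<^sup>+ x\<in>In. f x \<partial>\<nu>) + nn_integral_abs_diff \<nu> ?N (\<lambda>x. f x * indicator S x)"
    by (simp add: abs_diff_add outer inner)
  finally have split: "nn_integral_abs_diff \<nu> ?N f =
      (\<integral>\<^sup>+ x\<in>In. f x \<partial>\<nu>) + nn_integral_abs_diff \<nu> ?N (\<lambda>x. f x * indicator S x)" .
  have "(\<integral>\<^sup>+ x\<in>{x. norm x \<le> \<epsilon>}. f x \<partial>\<nu>) = (\<integral>\<^sup>+ x. f x * indicator In x + f x * indicator S x \<partial>\<nu>)"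
    by (intro nn_integral_cong) (auto simp: In_def S_def split: split_indicator)
  also have "\<dots> = (\<integral>\<^sup>+ x\<in>In. f x \<partial>\<nu>) + (\<integral>\<^sup>+ x\<in>S. f x \<partial>\<nu>)"
    by (intro nn_integral_add) simp_all
  finally have bound: "bound = (\<integral>\<^sup>+ x\<in>In. f x \<partial>\<nu>) + ((\<integral>\<^sup>+ x\<in>S. f x \<partial>\<nu>) + ?moment)"
    by (simp add: bound_def f_def add.assoc)
  have "nn_integral_abs_diff \<nu> ?N (\<lambda>x. f x * indicator S x) \<le> (\<integral>\<^sup>+ x\<in>S. f x \<partial>\<nu>) + ?moment"
    unfolding sphere[symmetric] by (rule abs_diff_le) measurable
  then show "nn_integral_abs_diff \<nu> ?N (\<lambda>x. ennreal ((norm x)^4)) \<le> bound"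
    unfolding f_def[symmetric] split bound by (rule add_left_mono)
  assume "emeasure \<nu> {x. norm x = \<epsilon>} = 0"
  then have null: "emeasure \<nu> S = 0"
    by (simp add: S_def)
  then have "(\<integral>\<^sup>+ x\<in>S. f x \<partial>\<nu>) = 0"
    by (intro nn_integral_null_set) (simp add: null_sets_def)
  then show "nn_integral_abs_diff \<nu> ?N (\<lambda>x. ennreal ((norm x)^4)) = bound"
    unfolding f_def[symmetric] split bound abs_diff_null_left[OF f S null] sphere by simp
qed

theorem proposition2:
  fixes \<nu> :: "(real ^ 'd) measure" and \<epsilon> :: real
  assumes levy: "levy_measure \<nu>"
    and third_moment: "(\<integral>\<^sup>+ x. ennreal ((norm x)^3) \<partial>\<nu>) < \<infinity>"
    and eps: "\<epsilon> > 0"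
  shows "let \<nu>\<^sub>\<epsilon> = three_moment_measure \<nu> \<epsilon> in
      finite_measure \<nu>\<^sub>\<epsilon> \<and>
      (\<forall>B\<in>sets borel. enn2ereal (emeasure \<nu>\<^sub>\<epsilon> B) = three_moment_charge \<nu> \<epsilon> B) \<and>
      (\<forall>i j. integrable \<nu> (\<lambda>x. x $ i * x $ j) \<and> integrable \<nu>\<^sub>\<epsilon> (\<lambda>x. x $ i * x $ j) \<and>
         (LINT x|\<nu>. x $ i * x $ j) = (LINT x|\<nu>\<^sub>\<epsilon>. x $ i * x $ j)) \<and>
      (\<forall>i j k. integrable \<nu> (\<lambda>x. x $ i * x $ j * x $ k) \<and>
         integrable \<nu>\<^sub>\<epsilon> (\<lambda>x. x $ i * x $ j * x $ k) \<and>
         (LINT x|\<nu>. x $ i * x $ j * x $ k) = (LINT x|\<nu>\<^sub>\<epsilon>. x $ i * x $ j * x $ k)) \<and>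
      emeasure \<nu>\<^sub>\<epsilon> UNIV = emeasure \<nu> {x. norm x > \<epsilon>} +
         ennreal (1 / \<epsilon>\<^sup>2) * (\<integral>\<^sup>+ x\<in>{x. norm x \<le> \<epsilon>}. ennreal ((norm x)\<^sup>2) \<partial>\<nu>) \<and>
      nn_integral_abs_diff \<nu> \<nu>\<^sub>\<epsilon> (\<lambda>x. ennreal ((norm x)^4)) \<le>
         (\<integral>\<^sup>+ x\<in>{x. norm x \<le> \<epsilon>}. ennreal ((norm x)^4) \<partial>\<nu>) +
         ennreal (\<epsilon>\<^sup>2) * (\<integral>\<^sup>+ x\<in>{x. norm x \<le> \<epsilon>}. ennreal ((norm x)\<^sup>2) \<partial>\<nu>) \<and>
      (emeasure \<nu> {x. norm x = \<epsilon>} = 0 \<longrightarrow>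
         nn_integral_abs_diff \<nu> \<nu>\<^sub>\<epsilon> (\<lambda>x. ennreal ((norm x)^4)) =
         (\<integral>\<^sup>+ x\<in>{x. norm x \<le> \<epsilon>}. ennreal ((norm x)^4) \<partial>\<nu>) +
         ennreal (\<epsilon>\<^sup>2) * (\<integral>\<^sup>+ x\<in>{x. norm x \<le> \<epsilon>}. ennreal ((norm x)\<^sup>2) \<partial>\<nu>))"
proof -
  have sets [measurable_cong]: "sets \<nu> = sets borel"
    using levy by (simp add: levy_measure_def)
  have int: "integrable \<nu> (\<lambda>x. norm x ^ n)" if "n = 2 \<or> n = 3" for n
    by (rule levy_integrable_power[OF levy third_moment that])
  have int2: "integrable \<nu> (\<lambda>x. (norm x)\<^sup>2)"
    by (rule int) simp
  have mass: "emeasure (scheme \<nu> \<epsilon>) UNIV = emeasure \<nu> {x. norm x > \<epsilon>} +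
      ennreal (1 / \<epsilon>\<^sup>2) * (\<integral>\<^sup>+ x\<in>{x. norm x \<le> \<epsilon>}. ennreal ((norm x)\<^sup>2) \<partial>\<nu>)"
  proof -
    have "emeasure (scheme \<nu> \<epsilon>) UNIV = (\<integral>\<^sup>+ y. 1 \<partial>scheme \<nu> \<epsilon>)"
      using sets_eq_imp_space_eq[of "scheme \<nu> \<epsilon>" borel] sets by simp
    also have "\<dots> = emeasure \<nu> {x. norm x > \<epsilon>} +
      ennreal (1 / \<epsilon>\<^sup>2) * (\<integral>\<^sup>+ x\<in>{x. norm x \<le> \<epsilon>}. ennreal ((norm x)\<^sup>2) \<partial>\<nu>)"
      using nn_integral_scheme_radial[OF sets eps, of "\<lambda>_. 1"] by (simp add: sets)
    finally show ?thesis .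
  qed
  have fin: "finite_measure (scheme \<nu> \<epsilon>)"
  proof (rule finite_measureI)
    have "(\<integral>\<^sup>+ x\<in>{x. norm x \<le> \<epsilon>}. ennreal ((norm x)\<^sup>2) \<partial>\<nu>) \<le> (\<integral>\<^sup>+ x. ennreal ((norm x)\<^sup>2) \<partial>\<nu>)"
      by (intro nn_integral_mono) (simp split: split_indicator)
    also have "\<dots> < \<infinity>"
      using int2 by (simp add: integrable_iff_bounded)
    finally have "emeasure (scheme \<nu> \<epsilon>) UNIV < \<infinity>"
      using emeasure_outside_ball_finite[OF sets int2 eps] by (simp add: mass ennreal_mult_less_top)
    then show "emeasure (scheme \<nu> \<epsilon>) (space (scheme \<nu> \<epsilon>)) \<noteq> \<infinity>"
      using sets_eq_imp_space_eq[of "scheme \<nu> \<epsilon>" borel] sets by simp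
  qed
  have moment: "integrable \<nu> f \<and> integrable (scheme \<nu> \<epsilon>) f \<and> (LINT x|\<nu>. f x) = (LINT x|scheme \<nu> \<epsilon>. f x)"
    if [measurable]: "f \<in> borel_measurable borel" and n: "n = 2 \<or> n = 3"
      and hom: "\<And>c x. f (c *\<^sub>R x) = c ^ n * f x" and le: "\<And>x. \<bar>f x\<bar> \<le> norm x ^ n"
    for f :: "real ^ 'd \<Rightarrow> real" and n
  proof (intro conjI)
    show "integrable \<nu> f"
      by (rule Bochner_Integration.integrable_bound[OF int[OF n]]) (use le in simp_all)
    show "integrable (scheme \<nu> \<epsilon>) f" "(LINT x|\<nu>. f x) = (LINT x|scheme \<nu> \<epsilon>. f x)"
      using homogeneous_moment[OF sets that(1) eps n hom le int2 int[OF n]] by simp_all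
  qed
  have second: "integrable \<nu> (\<lambda>x. x $ i * x $ j) \<and> integrable (scheme \<nu> \<epsilon>) (\<lambda>x. x $ i * x $ j) \<and>
      (LINT x|\<nu>. x $ i * x $ j) = (LINT x|scheme \<nu> \<epsilon>. x $ i * x $ j)" for i j
  proof (rule moment[where n = 2])
    show "\<bar>x $ i * x $ j\<bar> \<le> (norm x)\<^sup>2" for x :: "real ^ 'd"
      unfolding abs_mult power2_eq_square by (intro mult_mono component_le_norm_cart) auto
  qed (auto simp: power2_eq_square)
  have third: "integrable \<nu> (\<lambda>x. x $ i * x $ j * x $ k) \<and>
      integrable (scheme \<nu> \<epsilon>) (\<lambda>x. x $ i * x $ j * x $ k) \<and>
      (LINT x|\<nu>. x $ i * x $ j * x $ k) = (LINT x|scheme \<nu> \<epsilon>. x $ i * x $ j * x $ k)" for i j k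
  proof (rule moment[where n = 3])
    show "\<bar>x $ i * x $ j * x $ k\<bar> \<le> norm x ^ 3" for x :: "real ^ 'd"
      unfolding abs_mult power3_eq_cube by (intro mult_mono component_le_norm_cart) auto
  qed (auto simp: power3_eq_cube)
  have charge: "enn2ereal (emeasure (scheme \<nu> \<epsilon>) B) = three_moment_charge \<nu> \<epsilon> B" if "B \<in> sets borel" for B
    using three_moment_charge_eq_emeasure_scheme[OF sets that eps int2] by simp
  show ?thesis
    unfolding Let_def three_moment_measure_eq_scheme[OF sets eps int2]
    using fin charge second third mass abs_diff_scheme[OF levy eps int2 fin] by blast
qed

end
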